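(* (Frobenius reciprocity) Let $G$ be a finite group, let $X$ be a finite $G$-set, and let $Y$ be an invariant subset of $X$. Then $$\langle\mathrm{Ind}^X_Y f,\,g\rangle=\langle f,\,\mathrm{Res}^X_Y g\rangle$$ for all $f\in L^G(Y)$, $g\in L^G(X)$, where the left-hand inner product is that of $L(X)$ and the right-hand inner product is that of $L(Y)$.
   Context: A $G$-set is a nonempty set $X$ with an action of the group $G$, written $a\cdot x$. A nonempty subset $Y\subseteq X$ is invariant if $a\cdot y\in Y$ for all $a\in G$, $y\in Y$; then $Y$ is a $G$-set by restriction. For a finite $G$-set $Z$, $L(Z)$ is the complex vector space of all functions $Z\to\mathbb{C}$ with pointwise operations, $L^G(Z)=\{f\in L(Z)\colon f(a\cdot z)=f(z)\text{ for all }a\in G,z\in Z\}$, and the inner product on $L(Z)$ is $\langle f,g\rangle=\frac{1}{|Z|}\sum_{z\in Z}f(z)\overline{g(z)}$ (used with $Z=X$ and with $Z=Y$). The map $\mathrm{Res}^X_Y\colon L(X)\to L(Y)$ is restriction: $\mathrm{Res}^X_Y f(y)=f(y)$ for $y\in Y$. For $f\in L(Y)$, $\tilde f\in L(X)$ is defined by $\tilde f(x)=f(x)$ if $x\in Y$ and $\tilde f(x)=0$ otherwise. The map $\mathrm{Ind}^X_Y$ on $L(Y)$ is defined by $$\mathrm{Ind}^X_Y f(x)=\frac{|X|}{|G||Y|}\sum_{b\in G}\tilde f(b^{-1}\cdot x),\qquad x\in X.$$ *)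

theory Defs
  imports Complex_Main "HOL-Algebra.Group_Action"
begin

definition G_set :: "('a, 'm) monoid_scheme \<Rightarrow> 'b set \<Rightarrow> ('a \<Rightarrow> 'b \<Rightarrow> 'b) \<Rightarrow> bool" where
  "G_set G X \<phi> \<longleftrightarrow> group_action G X \<phi> \<and> X \<noteq> {}"

definition invariant_subset ::
  "('a, 'm) monoid_scheme \<Rightarrow> 'b set \<Rightarrow> ('a \<Rightarrow> 'b \<Rightarrow> 'b) \<Rightarrow> 'b set \<Rightarrow> bool" where
  "invariant_subset G X \<phi> Y \<longleftrightarrow>
     Y \<subseteq> X \<and> Y \<noteq> {} \<and> (\<forall>a \<in> carrier G. \<forall>y \<in> Y. \<phi> a y \<in> Y)"

definition res_action :: "('a \<Rightarrow> 'b \<Rightarrow> 'b) \<Rightarrow> 'b set \<Rightarrow> 'a \<Rightarrow> 'b \<Rightarrow> 'b" where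
  "res_action \<phi> Y = (\<lambda>a. restrict (\<phi> a) Y)"

text \<open>A function on the set \<open>Z\<close> is represented by its extensional representative,
  which is \<open>undefined\<close> outside \<open>Z\<close>.\<close>

definition L :: "'b set \<Rightarrow> ('b \<Rightarrow> complex) set" where
  "L Z = Z \<rightarrow>\<^sub>E UNIV"

definition L_inv ::
  "('a, 'm) monoid_scheme \<Rightarrow> 'b set \<Rightarrow> ('a \<Rightarrow> 'b \<Rightarrow> 'b) \<Rightarrow> ('b \<Rightarrow> complex) set" where
  "L_inv G Z \<phi> = {f \<in> L Z. \<forall>a \<in> carrier G. \<forall>z \<in> Z. f (\<phi> a z) = f z}"

definition L_inner :: "'b set \<Rightarrow> ('b \<Rightarrow> complex) \<Rightarrow> ('b \<Rightarrow> complex) \<Rightarrow> complex" where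
  "L_inner Z f g = 1 / of_nat (card Z) * (\<Sum>z\<in>Z. f z * cnj (g z))"

definition Res :: "'b set \<Rightarrow> ('b \<Rightarrow> complex) \<Rightarrow> 'b \<Rightarrow> complex" where
  "Res Y f = restrict f Y"

definition zero_ext :: "'b set \<Rightarrow> 'b set \<Rightarrow> ('b \<Rightarrow> complex) \<Rightarrow> 'b \<Rightarrow> complex" where
  "zero_ext X Y f = (\<lambda>x\<in>X. if x \<in> Y then f x else 0)"

definition Ind ::
  "('a, 'm) monoid_scheme \<Rightarrow> 'b set \<Rightarrow> ('a \<Rightarrow> 'b \<Rightarrow> 'b) \<Rightarrow> 'b set
    \<Rightarrow> ('b \<Rightarrow> complex) \<Rightarrow> 'b \<Rightarrow> complex" where
  "Ind G X \<phi> Y f =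
     (\<lambda>x\<in>X. of_nat (card X) / (of_nat (order G) * of_nat (card Y)) *
        (\<Sum>b\<in>carrier G. zero_ext X Y f (\<phi> (inv\<^bsub>G\<^esub> b) x)))"

lemma G_set_res_action:
  assumes "G_set G X \<phi>" and "invariant_subset G X \<phi> Y"
  shows "G_set G Y (res_action \<phi> Y)"
proof -
  interpret group_action G X \<phi> using assms(1) by (simp add: G_set_def)
  interpret group G using group_hom group_hom.axioms(1) by auto
  have sub: "Y \<subseteq> X" and ne: "Y \<noteq> {}"
    and inv: "\<And>a y. a \<in> carrier G \<Longrightarrow> y \<in> Y \<Longrightarrow> \<phi> a y \<in> Y"
    using assms(2) by (auto simp: invariant_subset_def)
  have bij: "res_action \<phi> Y a \<in> Bij Y" if a: "a \<in> carrier G" for a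
  proof -
    have "inj_on (\<phi> a) Y" using inj_prop[OF a] sub by (rule inj_on_subset)
    moreover have "\<phi> a ` Y = Y"
    proof
      show "\<phi> a ` Y \<subseteq> Y" using inv a by auto
      show "Y \<subseteq> \<phi> a ` Y"
      proof
        fix y assume y: "y \<in> Y"
        have "\<phi> a (\<phi> (inv\<^bsub>G\<^esub> a) y) = y"
          using orbit_sym_aux[of "inv\<^bsub>G\<^esub> a" y] a y sub by auto
        then show "y \<in> \<phi> a ` Y" using inv[of "inv\<^bsub>G\<^esub> a" y] a y by (metis imageI inv_closed)
      qed
    qed
    ultimately show ?thesis by (simp add: res_action_def Bij_def bij_betw_def)
  qed
  have "res_action \<phi> Y (a \<otimes>\<^bsub>G\<^esub> b) = compose Y (res_action \<phi> Y a) (res_action \<phi> Y b)"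
    if "a \<in> carrier G" "b \<in> carrier G" for a b
    using that sub inv composition_rule
    by (auto simp: res_action_def compose_def fun_eq_iff restrict_def)
  then have "res_action \<phi> Y \<in> hom G (BijGroup Y)"
    using bij by (auto simp: hom_def BijGroup_def)
  then have "group_action G Y (res_action \<phi> Y)"
    by (simp add: group_action_def group_hom_def group_hom_axioms_def group_BijGroup is_group)
  then show ?thesis using ne by (simp add: G_set_def)
qed

lemma Res_in_L: "Res Y f \<in> L Y"
  by (simp add: Res_def L_def PiE_def)

lemma Ind_in_L: "Ind G X \<phi> Y f \<in> L X"
  by (simp add: Ind_def L_def PiE_def)

end

theory Submission
  imports Defs
begin

text \<open>Since \<open>Y\<close> is invariant and \<open>f\<close> is an invariant function, the extension of \<open>f\<close> by zero is
  an invariant function on \<open>X\<close>. Averaging it over \<open>G\<close> changes nothing, so \<open>Ind f\<close> is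
  \<open>card X / card Y\<close> times that extension, and this factor converts the normalisation of the
  inner product on \<open>X\<close> into that on \<open>Y\<close>.\<close>

lemma zero_ext_invariant:
  assumes "group_action G X \<phi>" and "invariant_subset G X \<phi> Y"
    and "f \<in> L_inv G Y (res_action \<phi> Y)" and a: "a \<in> carrier G" and x: "x \<in> X"
  shows "zero_ext X Y f (\<phi> a x) = zero_ext X Y f x"
proof -
  interpret group_action G X \<phi> by fact
  interpret group G using group_hom group_hom.axioms(1) by auto
  have inv: "\<And>b y. b \<in> carrier G \<Longrightarrow> y \<in> Y \<Longrightarrow> \<phi> b y \<in> Y"
    using assms(2) by (auto simp: invariant_subset_def)
  \<comment> \<open>Invariance only says that \<open>a\<close> maps \<open>Y\<close> into itself;
    moving back by the inverse of \<open>a\<close> shows that points outside \<open>Y\<close> stay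
    outside.\<close>
  have "\<phi> (inv\<^bsub>G\<^esub> a) (\<phi> a x) = x"
    using orbit_sym_aux[OF a x] by simp
  then have "\<phi> a x \<in> Y \<longleftrightarrow> x \<in> Y"
    using inv a by (metis inv_closed)
  moreover have "f (\<phi> a x) = f x" if "x \<in> Y"
    using assms(3) a that by (simp add: L_inv_def res_action_def)
  \<comment> \<open>\<open>zero_ext\<close> is 0 only on \<open>X - Y\<close> and
    \<open>undefined\<close> off \<open>X\<close>, so \<open>\<phi> a x\<close> must be known to lie
    in \<open>X\<close>.\<close>
  ultimately show ?thesis
    using x element_image[OF a x refl] by (simp add: zero_ext_def)
qed

lemma Ind_eq_zero_ext:
  assumes "group_action G X \<phi>" and "finite (carrier G)" and "invariant_subset G X \<phi> Y"
    and "f \<in> L_inv G Y (res_action \<phi> Y)" and x: "x \<in> X"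
  shows "Ind G X \<phi> Y f x = of_nat (card X) / of_nat (card Y) * zero_ext X Y f x"
proof -
  interpret group_action G X \<phi> by fact
  interpret group G using group_hom group_hom.axioms(1) by auto
  \<comment> \<open>Needed to cancel \<open>order G\<close> against the equally many equal
    summands.\<close>
  have "order G \<noteq> 0"
    using assms(2) order_gt_0_iff_finite by auto
  moreover have "(\<Sum>b\<in>carrier G. zero_ext X Y f (\<phi> (inv\<^bsub>G\<^esub> b) x)) =
      of_nat (order G) * zero_ext X Y f x"
    using zero_ext_invariant[OF assms(1,3,4) _ x] by (simp add: order_def)
  ultimately show ?thesis
    using x by (simp add: Ind_def)
qed

theorem theorem3p14:
  fixes G :: "('a, 'm) monoid_scheme"
    and X Y :: "'b set"
    and \<phi> :: "'a \<Rightarrow> 'b \<Rightarrow> 'b"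
    and f g :: "'b \<Rightarrow> complex"
  assumes "group G" and "finite (carrier G)"
    and "G_set G X \<phi>" and "finite X"
    and "invariant_subset G X \<phi> Y"
    and "f \<in> L_inv G Y (res_action \<phi> Y)"
    and "g \<in> L_inv G X \<phi>"
  shows "L_inner X (Ind G X \<phi> Y f) g = L_inner Y f (Res Y g)"
proof -
  have action: "group_action G X \<phi>" and "X \<noteq> {}"
    using assms(3) by (auto simp: G_set_def)
  \<comment> \<open>Lets the factor \<open>card X\<close> from \<open>Ind\<close> cancel the
    normalisation of the inner product on \<open>X\<close>.\<close>
  then have card_X: "card X \<noteq> 0"
    using assms(4) by simp
  have sub: "Y \<subseteq> X"
    using assms(5) by (simp add: invariant_subset_def)
  \<comment> \<open>The terms over \<open>X - Y\<close> vanish, and on \<open>Y\<close> restriction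
    leaves \<open>g\<close> unchanged.\<close>
  have "(\<Sum>x\<in>X. zero_ext X Y f x * cnj (g x)) = (\<Sum>y\<in>Y. f y * cnj (Res Y g y))"
    using sub assms(4) by (intro sum.mono_neutral_cong_right) (auto simp: zero_ext_def Res_def)
  moreover have "(\<Sum>x\<in>X. Ind G X \<phi> Y f x * cnj (g x)) =
      of_nat (card X) / of_nat (card Y) * (\<Sum>x\<in>X. zero_ext X Y f x * cnj (g x))"
    using Ind_eq_zero_ext[OF action assms(2,5,6)] by (simp add: sum_distrib_left mult.assoc)
  ultimately show ?thesis
    using card_X by (simp add: L_inner_def)
qed

end
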